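(* Let $\lambda\in\mathbb{C}^*$. Then the quandle $M_{\lambda,-\lambda}$ is a $2$-connected quandle.
   Context: A quandle is a non-empty set $Q$ with a binary operation $*$ such that: (Q1) $x*x=x$ for all $x$; (Q2) for all $x,y\in Q$ there is a unique $z\in Q$ with $x=z*y$; (Q3) $(x*y)*z=(x*z)*(y*z)$ for all $x,y,z$. Products without parentheses are left-associated. $Q$ is $1$-connected if $L_x:Q\to Q$, $L_x(y)=x*y$, is surjective for each $x\in Q$. $Q$ is $2$-connected if it is not $1$-connected and for any $x,y\in Q$ there are $1\le l,l'\le 2$ and $z_i,z'_j\in Q$ with $x=y*z_1*\cdots*z_l$ and $y=x*z'_1*\cdots*z'_{l'}$. For $\lambda_1,\lambda_2\in\mathbb{C}^*$, $M_{\lambda_1,\lambda_2}$ is the conjugacy class in $\operatorname{GL}(2,\mathbb{C})$ of the diagonal matrix $\begin{pmatrix}\lambda_1&0\\0&\lambda_2\end{pmatrix}$, regarded as a quandle with operation $X*Y=Y^{-1}XY$. *)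

theory Defs
  imports "HOL-Analysis.Determinants"
begin

definition quandle :: "'a set \<Rightarrow> ('a \<Rightarrow> 'a \<Rightarrow> 'a) \<Rightarrow> bool" where
  "quandle Q op \<longleftrightarrow>
     Q \<noteq> {} \<and>
     (\<forall>x\<in>Q. \<forall>y\<in>Q. op x y \<in> Q) \<and>
     (\<forall>x\<in>Q. op x x = x) \<and>
     (\<forall>x\<in>Q. \<forall>y\<in>Q. \<exists>!z. z \<in> Q \<and> x = op z y) \<and>
     (\<forall>x\<in>Q. \<forall>y\<in>Q. \<forall>z\<in>Q. op (op x y) z = op (op x z) (op y z))"

definition one_connected :: "'a set \<Rightarrow> ('a \<Rightarrow> 'a \<Rightarrow> 'a) \<Rightarrow> bool" where
  "one_connected Q op \<longleftrightarrow> (\<forall>x\<in>Q. op x ` Q = Q)"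

text \<open>The left-associated product of \<open>y\<close> with \<open>z\<^sub>1, \<dots>, z\<^sub>l\<close> is
  \<open>foldl op y [z\<^sub>1, \<dots>, z\<^sub>l]\<close>.\<close>

definition two_connected :: "'a set \<Rightarrow> ('a \<Rightarrow> 'a \<Rightarrow> 'a) \<Rightarrow> bool" where
  "two_connected Q op \<longleftrightarrow>
     \<not> one_connected Q op \<and>
     (\<forall>x\<in>Q. \<forall>y\<in>Q.
        (\<exists>zs. set zs \<subseteq> Q \<and> 1 \<le> length zs \<and> length zs \<le> 2 \<and> x = foldl op y zs) \<and>
        (\<exists>zs'. set zs' \<subseteq> Q \<and> 1 \<le> length zs' \<and> length zs' \<le> 2 \<and> y = foldl op x zs'))"

definition diag2 :: "complex \<Rightarrow> complex \<Rightarrow> complex^2^2" where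
  "diag2 a b = vector [vector [a, 0], vector [0, b]]"

definition conj_op :: "complex^2^2 \<Rightarrow> complex^2^2 \<Rightarrow> complex^2^2" where
  "conj_op X Y = matrix_inv Y ** X ** Y"

definition conj_class_GL2 :: "complex^2^2 \<Rightarrow> (complex^2^2) set" where
  "conj_class_GL2 A = {conj_op A P | P. invertible P}"

definition M :: "complex \<Rightarrow> complex \<Rightarrow> (complex^2^2) set" where
  "M l1 l2 = conj_class_GL2 (diag2 l1 l2)"

end

theory Submission imports Defs begin

text \<open>
  The conjugacy class of \<open>diag(l, -l)\<close> consists of the traceless matrices of determinant
  \<open>-l\<^sup>2\<close> (lemma \<open>M_eq_traceless\<close>), so by Cayley--Hamilton each of its elements squares
  to the scalar \<open>l\<^sup>2\<close>. On such matrices conjugation is very explicit: from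
  \<open>X\<^sup>2 = Y\<^sup>2\<close> one gets \<open>X (X + Y) = (X + Y) Y\<close>, so \<open>X + Y\<close>, whenever it
  is invertible, conjugates \<open>X\<close> to \<open>Y\<close>. Being traceless, \<open>X + Y\<close> can be rescaled to
  lie in the class, and then \<open>Y = X * Z\<close> with \<open>Z\<close> in the class.

  If \<open>X + Y\<close> is singular, the parallelogram law for the determinant on the plane spanned by
  \<open>X\<close> and \<open>Y\<close> shows that \<open>X - Y\<close> is invertible, so one step leads from \<open>X\<close> to
  \<open>-Y\<close>; a second step leads from \<open>-Y\<close> to \<open>Y\<close>, since each element of the class
  anticommutes with another element of the class. Hence two steps always suffice.

  One step does not: if an element \<open>Z\<close> of the class conjugates \<open>X\<close> to \<open>Y\<close> then \<open>X + Y\<close> is a scalar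
  multiple of \<open>Z\<close>, so \<open>X + Y\<close> cannot be nilpotent and nonzero. The matrices
  \<open>X = diag(l, -l)\<close> and \<open>Y\<close> with rows \<open>(-l, 1)\<close> and \<open>(0, l)\<close> have such a sum.
\<close>

section \<open>Conjugation of invertible matrices\<close>

lemma matrix_inv_cancel:
  fixes P :: "'a::comm_ring_1^'n^'n"
  assumes "invertible P"
  shows "matrix_inv P ** P = mat 1" "P ** matrix_inv P = mat 1"
  using someI_ex[OF assms[unfolded invertible_def]] unfolding matrix_inv_def by auto

lemma invertible_matrix_inv:
  fixes P :: "'a::comm_ring_1^'n^'n"
  assumes "invertible P"
  shows "invertible (matrix_inv P)"
  using matrix_inv_cancel[OF assms] unfolding invertible_def by blast

text \<open>Intertwining identities avoid inverses; almost every conjugation below is computed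
  through this criterion.\<close>

lemma conj_op_eq_iff:
  assumes "invertible P"
  shows "conj_op X P = W \<longleftrightarrow> X ** P = P ** W"
proof
  assume W: "conj_op X P = W"
  have "P ** conj_op X P = (P ** matrix_inv P) ** (X ** P)"
    by (simp add: conj_op_def matrix_mul_assoc)
  then show "X ** P = P ** W"
    by (simp add: W matrix_inv_cancel[OF assms])
next
  assume W: "X ** P = P ** W"
  have "conj_op X P = matrix_inv P ** (X ** P)"
    by (simp add: conj_op_def matrix_mul_assoc)
  also have "\<dots> = W"
    by (simp add: W matrix_mul_assoc matrix_inv_cancel[OF assms])
  finally show "conj_op X P = W" .
qed

lemma conj_op_intertwines:
  assumes "invertible P"
  shows "X ** P = P ** conj_op X P"
  by (simp flip: conj_op_eq_iff[OF assms])

lemma conj_op_conj_op: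
  assumes "invertible P" "invertible Q"
  shows "conj_op (conj_op X P) Q = conj_op X (P ** Q)"
proof -
  have "X ** (P ** Q) = P ** (conj_op X P ** Q)"
    by (simp add: matrix_mul_assoc conj_op_intertwines[OF assms(1), of X])
  also have "\<dots> = (P ** Q) ** conj_op (conj_op X P) Q"
    by (simp add: conj_op_intertwines[OF assms(2), of "conj_op X P"] matrix_mul_assoc)
  finally have "X ** (P ** Q) = (P ** Q) ** conj_op (conj_op X P) Q" .
  then show ?thesis
    by (rule conj_op_eq_iff[THEN iffD2, OF invertible_mult[OF assms], symmetric])
qed

lemma conj_op_mult:
  assumes "invertible P"
  shows "conj_op (X ** Y) P = conj_op X P ** conj_op Y P"
proof -
  have "(X ** Y) ** P = X ** (P ** conj_op Y P)"
    by (simp add: conj_op_intertwines[OF assms, of Y] flip: matrix_mul_assoc)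
  also have "\<dots> = P ** (conj_op X P ** conj_op Y P)"
    by (simp add: matrix_mul_assoc conj_op_intertwines[OF assms, of X])
  finally have "(X ** Y) ** P = P ** (conj_op X P ** conj_op Y P)" .
  then show ?thesis
    by (simp add: conj_op_eq_iff[OF assms])
qed

lemma invertible_conj_op:
  assumes "invertible X" "invertible P"
  shows "invertible (conj_op X P)"
  unfolding conj_op_def
  by (intro invertible_mult invertible_matrix_inv assms)

lemma conj_op_distrib:
  assumes "invertible Y" "invertible P"
  shows "conj_op (conj_op X Y) P = conj_op (conj_op X P) (conj_op Y P)"
proof -
  have "conj_op X P ** conj_op Y P = conj_op (X ** Y) P"
    by (simp add: conj_op_mult assms)
  also have "\<dots> = conj_op (Y ** conj_op X Y) P"
    by (simp add: conj_op_intertwines[OF assms(1), of X])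
  also have "\<dots> = conj_op Y P ** conj_op (conj_op X Y) P"
    by (simp add: conj_op_mult assms)
  finally show ?thesis
    by (rule conj_op_eq_iff[THEN iffD2, OF invertible_conj_op[OF assms], symmetric])
qed

lemma conj_op_self:
  assumes "invertible X"
  shows "conj_op X X = X"
  by (simp add: conj_op_eq_iff[OF assms])

lemma conj_op_matrix_inv:
  assumes "invertible P"
  shows "conj_op (conj_op X (matrix_inv P)) P = X" "conj_op (conj_op X P) (matrix_inv P) = X"
proof -
  have "conj_op X (mat 1) = X"
    using conj_op_eq_iff[of "mat 1" X X] by (simp add: invertible_def)
  then show "conj_op (conj_op X (matrix_inv P)) P = X"
    and "conj_op (conj_op X P) (matrix_inv P) = X"
    by (simp_all add: conj_op_conj_op matrix_inv_cancel invertible_matrix_inv assms)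
qed

lemma conj_op_uminus: "conj_op (- X) P = - conj_op X P"
  by (simp add: conj_op_def vec_eq_iff matrix_matrix_mult_def sum_negf)

lemma conj_class_closed:
  assumes "X \<in> conj_class_GL2 A" "invertible P"
  shows "conj_op X P \<in> conj_class_GL2 A"
  using assms unfolding conj_class_GL2_def by (auto simp: conj_op_conj_op intro: invertible_mult)

lemma conj_class_invertible:
  assumes "invertible A" "X \<in> conj_class_GL2 A"
  shows "invertible X"
  using assms unfolding conj_class_GL2_def by (auto simp: invertible_conj_op)

lemma quandle_conj_class:
  assumes "invertible A"
  shows "quandle (conj_class_GL2 A) conj_op"
proof -
  let ?Q = "conj_class_GL2 A"
  note inv = conj_class_invertible[OF assms]
  have "conj_op A A \<in> ?Q"
    using assms unfolding conj_class_GL2_def by blast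
  moreover have "\<exists>!z. z \<in> ?Q \<and> x = conj_op z y" if "x \<in> ?Q" "y \<in> ?Q" for x y
  proof (rule ex1I[of _ "conj_op x (matrix_inv y)"])
    show "conj_op x (matrix_inv y) \<in> ?Q \<and> x = conj_op (conj_op x (matrix_inv y)) y"
      using that by (simp add: conj_class_closed conj_op_matrix_inv inv invertible_matrix_inv)
    show "z = conj_op x (matrix_inv y)" if "z \<in> ?Q \<and> x = conj_op z y" for z
      using that conj_op_matrix_inv(2)[OF inv[OF \<open>y \<in> ?Q\<close>], of z] by simp
  qed
  ultimately show ?thesis
    unfolding quandle_def
    by (intro conjI ballI conj_class_closed conj_op_self conj_op_distrib inv) auto
qed

section \<open>Traceless two-by-two matrices\<close>

lemma mat2_eq_iff:
  "(X::'a^2^2) = Y \<longleftrightarrow> X$1$1 = Y$1$1 \<and> X$1$2 = Y$1$2 \<and> X$2$1 = Y$2$1 \<and> X$2$2 = Y$2$2"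
  by (auto simp: vec_eq_iff forall_2)

lemma mat2_mult_nth:
  "((X::'a::comm_ring_1^2^2) ** Y)$i$j = X$i$1 * Y$1$j + X$i$2 * Y$2$j"
  by (simp add: matrix_matrix_mult_def sum_2)

lemma mat2_scalar_nth:
  "(mat k :: 'a::comm_ring_1^2^2)$1$1 = k" "(mat k :: 'a^2^2)$1$2 = 0"
  "(mat k :: 'a^2^2)$2$1 = 0" "(mat k :: 'a^2^2)$2$2 = k"
  by (simp_all add: mat_def)

lemma trace_2: "trace (X::'a::comm_ring_1^2^2) = X$1$1 + X$2$2"
  by (simp add: trace_def sum_2)

lemma traceless_22:
  assumes "trace (X::'a::comm_ring_1^2^2) = 0"
  shows "X$2$2 = - X$1$1"
  using assms by (simp add: trace_2 eq_neg_iff_add_eq_0 add.commute)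

text \<open>This is Cayley--Hamilton for a vanishing trace.\<close>

lemma traceless_square:
  fixes X :: "'a::comm_ring_1^2^2"
  assumes "trace X = 0"
  shows "X ** X = mat (- det X)"
  by (simp add: mat2_eq_iff mat2_mult_nth mat2_scalar_nth det_2 traceless_22[OF assms])

text \<open>The determinant of two-by-two matrices is a quadratic form, so the parallelogram law
  holds. Over the complex numbers, two points on the same nonzero level therefore have an
  invertible sum or an invertible difference.\<close>

lemma det_2_parallelogram:
  fixes X Y :: "'a::comm_ring_1^2^2"
  shows "det (X + Y) + det (X - Y) = 2 * det X + 2 * det Y"
  by (simp add: det_2 algebra_simps)

text \<open>Both sides equal \<open>X\<^sup>2 + X Y = X Y + Y\<^sup>2\<close>, because the two squares are the
  same scalar.\<close>

lemma sum_intertwines: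
  fixes X Y :: "'a::comm_ring_1^2^2"
  assumes "trace X = 0" "trace Y = 0" "det X = det Y"
  shows "X ** (X + Y) = (X + Y) ** Y"
proof -
  have "X ** X = Y ** Y"
    using assms by (simp add: traceless_square)
  then show ?thesis
    by (simp add: mat2_eq_iff mat2_mult_nth algebra_simps)
qed

lemma det_uminus_2: "det (- X :: 'a::comm_ring_1^2^2) = det X"
  by (simp add: det_2)

lemma trace_uminus_2: "trace (- X :: 'a::comm_ring_1^2^2) = - trace X"
  by (simp add: trace_2)

lemma trace_conj_op:
  assumes "invertible P"
  shows "trace (conj_op X P) = trace X"
proof -
  have "trace (conj_op X P) = trace (P ** (matrix_inv P ** X))"
    unfolding conj_op_def by (rule trace_mul_sym)
  then show ?thesis
    by (simp add: matrix_mul_assoc matrix_inv_cancel assms)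
qed

lemma det_conj_op:
  assumes "invertible P"
  shows "det (conj_op X P) = det X"
proof -
  have "det X * det P = det P * det (conj_op X P)"
    using arg_cong[OF conj_op_intertwines[OF assms, of X], of det] by (simp add: det_mul)
  then show ?thesis
    using assms by (simp add: invertible_det_nz)
qed

section \<open>The conjugacy class of \<open>diag(l, -l)\<close>\<close>

definition antidiag :: "complex \<Rightarrow> complex^2^2" where
  "antidiag l = vector [vector [0, l], vector [l, 0]]"

lemma diag2_traceless: "trace (diag2 l (- l)) = 0" "det (diag2 l (- l)) = - l\<^sup>2"
  by (simp_all add: diag2_def trace_2 det_2 power2_eq_square)

lemma antidiag_traceless: "trace (antidiag l) = 0" "det (antidiag l) = - l\<^sup>2"
  by (simp_all add: antidiag_def trace_2 det_2 power2_eq_square)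

lemma antidiag_invertible: "l \<noteq> 0 \<Longrightarrow> invertible (antidiag l)"
  by (simp add: invertible_det_nz antidiag_traceless)

lemma conj_op_diag2_antidiag:
  assumes "l \<noteq> 0"
  shows "conj_op (diag2 l (- l)) (antidiag l) = - diag2 l (- l)"
  unfolding conj_op_eq_iff[OF antidiag_invertible[OF assms]]
  by (simp add: mat2_eq_iff mat2_mult_nth diag2_def antidiag_def)

text \<open>A traceless \<open>X\<close> of the right determinant is conjugate to \<open>D = diag(l, -l)\<close> through
  \<open>D + X\<close> if that sum is invertible. Otherwise \<open>-X\<close> is conjugate to \<open>D\<close> through
  \<open>D - X\<close>, and it remains to use that \<open>-D\<close> is conjugate to \<open>D\<close>.\<close>

lemma M_eq_traceless:
  assumes "l \<noteq> 0"
  shows "M l (- l) = {X. trace X = 0 \<and> det X = - l\<^sup>2}"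
proof (intro equalityI subsetI)
  fix X assume "X \<in> M l (- l)"
  then show "X \<in> {X. trace X = 0 \<and> det X = - l\<^sup>2}"
    by (auto simp: M_def conj_class_GL2_def trace_conj_op det_conj_op diag2_traceless)
next
  let ?D = "diag2 l (- l)"
  have conj: "\<exists>P. invertible P \<and> conj_op ?D P = X"
    if "trace X = 0" "det X = - l\<^sup>2" "det (?D + X) \<noteq> 0" for X
  proof -
    have "invertible (?D + X)"
      using that by (simp add: invertible_det_nz)
    moreover from this have "conj_op ?D (?D + X) = X"
      using sum_intertwines[of ?D X] that by (simp add: conj_op_eq_iff diag2_traceless)
    ultimately show ?thesis
      by blast
  qed
  fix X :: "complex^2^2"
  assume "X \<in> {X. trace X = 0 \<and> det X = - l\<^sup>2}"
  then have X: "trace X = 0" "det X = - l\<^sup>2"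
    by auto
  have "\<exists>P. invertible P \<and> conj_op ?D P = X"
  proof (cases "det (?D + X) = 0")
    case True
    then have "det (?D - X) = - 4 * l\<^sup>2"
      using det_2_parallelogram[of ?D X] X by (simp add: diag2_traceless)
    then have "det (?D + - X) \<noteq> 0"
      using assms by simp
    then obtain P where P: "invertible P" "conj_op ?D P = - X"
      using conj[of "- X"] X by (auto simp: trace_uminus_2 det_uminus_2)
    then have "conj_op ?D (antidiag l ** P) = X"
      using conj_op_conj_op[of "antidiag l" P ?D]
      by (simp add: antidiag_invertible conj_op_diag2_antidiag conj_op_uminus assms)
    then show ?thesis
      using P invertible_mult[OF antidiag_invertible[OF assms]] by blast
  next
    case False
    then show ?thesis
      by (rule conj[OF X])
  qed
  then show "X \<in> M l (- l)"
    unfolding M_def conj_class_GL2_def by blast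
qed

lemma M_invertible:
  assumes "l \<noteq> 0" "X \<in> M l (- l)"
  shows "invertible X"
  using assms by (simp add: M_eq_traceless invertible_det_nz)

lemma M_uminus:
  assumes "l \<noteq> 0" "X \<in> M l (- l)"
  shows "- X \<in> M l (- l)"
  using assms by (simp add: M_eq_traceless trace_uminus_2 det_uminus_2)

section \<open>Connectivity\<close>

text \<open>The matrix \<open>X + Y\<close> already does the conjugation; a scalar factor does not change this
  and adjusts the determinant so that the conjugator lies in the class.\<close>

lemma one_step:
  assumes l: "l \<noteq> 0" and X: "X \<in> M l (- l)" and Y: "Y \<in> M l (- l)"
    and nz: "det (X + Y) \<noteq> 0"
  shows "\<exists>Z\<in>M l (- l). conj_op X Z = Y"
proof -
  define m where "m = csqrt (- l\<^sup>2 / det (X + Y))"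
  define Z where "Z = mat m ** (X + Y)"
  have XY: "trace X = 0" "trace Y = 0" "det X = - l\<^sup>2" "det Y = - l\<^sup>2"
    using X Y by (simp_all add: M_eq_traceless l)
  have "det Z = m\<^sup>2 * det (X + Y)"
    by (simp add: Z_def det_mul det_2[of "mat m"] mat2_scalar_nth power2_eq_square)
  also have "\<dots> = - l\<^sup>2"
    using nz by (simp add: m_def)
  finally have "det Z = - l\<^sup>2" .
  moreover have "trace Z = 0"
    using traceless_22[OF XY(1)] traceless_22[OF XY(2)]
    by (simp add: Z_def trace_2 mat2_mult_nth mat2_scalar_nth algebra_simps)
  ultimately have Z: "Z \<in> M l (- l)"
    by (simp add: M_eq_traceless l)
  have "X ** mat m = mat m ** X"
    by (simp add: mat2_eq_iff mat2_mult_nth mat2_scalar_nth)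
  then have "X ** Z = mat m ** (X ** (X + Y))"
    by (simp add: Z_def matrix_mul_assoc)
  also have "\<dots> = Z ** Y"
    using sum_intertwines[of X Y] XY by (simp add: Z_def matrix_mul_assoc)
  finally have "conj_op X Z = Y"
    by (simp add: conj_op_eq_iff M_invertible[OF l Z])
  then show ?thesis
    using Z by blast
qed

text \<open>The antidiagonal matrix anticommutes with \<open>diag(l, -l)\<close>; conjugating both by
  the same matrix carries this relation to every \<open>X\<close> in the class.\<close>

lemma antipode_step:
  assumes l: "l \<noteq> 0" and X: "X \<in> M l (- l)"
  shows "\<exists>Z\<in>M l (- l). conj_op X Z = - X"
proof -
  obtain P where P: "invertible P" "X = conj_op (diag2 l (- l)) P"
    using X by (auto simp: M_def conj_class_GL2_def)
  have "conj_op X (conj_op (antidiag l) P) = - X"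
    using conj_op_distrib[OF antidiag_invertible[OF l] P(1), of "diag2 l (- l)"]
    by (simp add: P(2) conj_op_diag2_antidiag[OF l] conj_op_uminus)
  moreover have "conj_op (antidiag l) P \<in> M l (- l)"
    by (simp add: M_eq_traceless l trace_conj_op det_conj_op P(1) antidiag_traceless)
  ultimately show ?thesis
    by blast
qed

lemma two_steps:
  assumes l: "l \<noteq> 0" and X: "X \<in> M l (- l)" and Y: "Y \<in> M l (- l)"
  shows "\<exists>zs. set zs \<subseteq> M l (- l) \<and> 1 \<le> length zs \<and> length zs \<le> 2 \<and> Y = foldl conj_op X zs"
proof (cases "det (X + Y) = 0")
  case False
  then obtain Z where "Z \<in> M l (- l)" "conj_op X Z = Y"
    using one_step[OF l X Y] by blast
  then show ?thesis
    by (intro exI[of _ "[Z]"]) auto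
next
  case True
  then have "det (X - Y) = - 4 * l\<^sup>2"
    using det_2_parallelogram[of X Y] X Y by (simp add: M_eq_traceless l)
  then have "det (X + - Y) \<noteq> 0"
    using l by simp
  then obtain Z where Z: "Z \<in> M l (- l)" "conj_op X Z = - Y"
    using one_step[OF l X M_uminus[OF l Y]] by blast
  obtain W where W: "W \<in> M l (- l)" "conj_op (- Y) W = Y"
    using antipode_step[OF l M_uminus[OF l Y]] by auto
  show ?thesis
    using Z W by (intro exI[of _ "[Z, W]"]) auto
qed

text \<open>The matrix \<open>W\<close> is chosen so that \<open>diag(l, -l) + W\<close> is nilpotent and nonzero. A
  traceless \<open>Z\<close> intertwining \<open>diag(l, -l)\<close> with \<open>W\<close> is proportional to this sum,
  hence singular.\<close>

lemma not_one_connected: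
  assumes l: "l \<noteq> 0"
  shows "\<not> one_connected (M l (- l)) conj_op"
proof
  assume con: "one_connected (M l (- l)) conj_op"
  define W :: "complex^2^2" where "W = vector [vector [- l, 1], vector [0, l]]"
  have "W \<in> M l (- l)"
    by (simp add: M_eq_traceless l W_def trace_2 det_2 power2_eq_square)
  moreover have "diag2 l (- l) \<in> M l (- l)"
    by (simp add: M_eq_traceless l diag2_traceless)
  ultimately have "W \<in> conj_op (diag2 l (- l)) ` M l (- l)"
    using con by (simp add: one_connected_def)
  then obtain Z where Z: "Z \<in> M l (- l)" "conj_op (diag2 l (- l)) Z = W"
    by auto
  have "diag2 l (- l) ** Z = Z ** W"
    using Z by (simp add: conj_op_eq_iff M_invertible[OF l])
  then have eqs: "l * Z$1$1 = - (l * Z$1$1)" "- (l * Z$2$2) = Z$2$1 + l * Z$2$2"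
    by (simp_all add: mat2_eq_iff mat2_mult_nth diag2_def W_def mult.commute)
  have "Z$1$1 = 0"
    using eqs(1) l by simp
  moreover from this have "Z$2$2 = 0"
    using Z(1) traceless_22[of Z] by (simp add: M_eq_traceless l)
  ultimately have "det Z = 0"
    using eqs(2) by (simp add: det_2)
  then show False
    using Z(1) l by (simp add: M_eq_traceless)
qed

theorem theorem4p11:
  fixes l :: complex
  assumes "l \<noteq> 0"
  shows "quandle (M l (- l)) conj_op \<and> two_connected (M l (- l)) conj_op"
proof
  have "invertible (diag2 l (- l))"
    using assms by (simp add: invertible_det_nz diag2_traceless)
  then show "quandle (M l (- l)) conj_op"
    unfolding M_def by (rule quandle_conj_class)
  show "two_connected (M l (- l)) conj_op"
    unfolding two_connected_def
    by (intro conjI ballI not_one_connected two_steps assms)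
qed

end
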